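(* Let $(M,H,V,P,\mu,\phi,\psi)$, together with given right actions of $H$ and $V$ on $M$, be a double $P$-module. Let $D$ be the set of quintuples $(m:u\,{}^{a}_{c}\,v)$ with $m\in M$, $a,c\in H$, $u,v\in V$ such that $av=ucm$ evaluated in $P$. Define partial compositions on $D$ by $$(m:u\,{}^{a}_{c}\,v)\circ_2(n:v\,{}^{b}_{d}\,w)=(m^{d}\,n:u\,{}^{ab}_{cd}\,w),$$ $$(m:u\,{}^{a}_{c}\,v)\circ_1(p:x\,{}^{c}_{e}\,y)=(p\,m^{y}:ux\,{}^{a}_{e}\,vy).$$ Then $\circ_1,\circ_2$ give $D$ the structure of a double category, with category of horizontal edges $H$ and category of vertical edges $V$. This double category is a double groupoid if all of $M,H,V,P$ are groupoids.
   Context: Categories: for a category $C$, $\mathsf s,\mathsf t$ denote the source and target maps. Composition is written in diagrammatic order, so $cd$ is defined if and only if $\mathsf t c=\mathsf s d$. Double $P$-module: it consists of categories $M,H,V,P$ with the same set of objects and functors $\mu:M\to P$, $\phi:H\to P$, $\psi:V\to P$, each the identity on objects, such that $M$ is totally intransitive, i.e. $\mathsf s=\mathsf t$ on $M$, so $M$ is a disjoint union of monoids $M(x)=M(x,x)$. Further there are given right actions of both $H$ and $V$ on $M$: for $m\in M(x)$ and $d\in H(x,y)$ there is defined $m^d\in M(y)$ such that $(mm_1)^h=m^hm_1^h$, $m^{hk}=(m^h)^k$, $1^h=1$, $m^1=m$ whenever these make sense, and similarly for $V$. The two actions are not supposed to commute. For $d\in H$, $z\in V$ with $\mathsf t m=\mathsf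 s d$, $\mathsf t d=\mathsf s z$, the notation $m^{dz}$ means $(m^d)^z$, and similarly $m^{yf}=(m^y)^f$ for $y\in V$, $f\in H$ with $\mathsf t m=\mathsf s y$, $\mathsf t y=\mathsf s f$. "Evaluated in $P$": an equation among arrows of $M,H,V$ "evaluated in $P$" (or "in $P$") means that the sources and targets are such that the equation makes sense, and that the equation holds in $P$ after applying $\mu,\phi,\psi$ to the elements of $M,H,V$ respectively. For example, for $a,c\in H$, $u,v\in V$, $m\in M$, "$av=ucm$ evaluated in $P$" means that $\mathsf s a=\mathsf s u$, $\mathsf t a=\mathsf s v$, $\mathsf t u=\mathsf s c$, $\mathsf t c=\mathsf t v=\mathsf t m$ and $\phi(a)\psi(v)=\psi(u)\phi(c)\mu(m)$ in $P$. Axioms of a double $P$-module, for $m,q\in M$, $d,f\in H$, $y,z\in V$: (i) $md=dm^d$ evaluated in $P$ whenever $\mathsf t m=\mathsf s d$, i.e. $\mu(m)\phi(d)=\phi(d)\mu(m^d)$; and $my=ym^y$ evaluated in $P$ whenever $\mathsf t m=\mathsf s y$, i.e. $\mu(m)\psi(y)=\psi(y)\mu(m^y)$. (ii) If $yfq=dz$ evaluated in $P$, and $m$ is at the object $\mathsf s y=\mathsf s d$, then $m^{yf}\,q=q\,m^{dz}$ in $M$. The quintuple $(m:u\,{}^{a}_{c}\,v)$ is thought of as a square with top edge $a$, bottom edge $c$, left edge $u$, right edge $v$. Thus $\circ_2$ (horizontal composition) is defined when the right edge of the first square equals the left edge of the second, and $\circ_1$ (vertical composition) is defined when the bottom edge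 of the first equals the top edge of the second. Double category: a set of squares with horizontal and vertical edges forming categories over the same set of objects, such that the squares form a category under $\circ_2$ with objects the vertical edges and a category under $\circ_1$ with objects the horizontal edges, with the boundary and identity maps compatible with the compositions, and the interchange law holding (the two ways of composing a $2\times2$ array of composable squares agree). It is a double groupoid if all four category structures are groupoids. *)

theory Defs
  imports Main
begin

section \<open>Categories and functors\<close>

text \<open>
  Composition is in diagrammatic order: \<open>f \<cdot>\<^bsub>C\<^esub> g\<close> is meaningful exactly when
  \<open>Tgt C f = Src C g\<close>. Partiality is modelled by a total function about which nothing is
  assumed outside the composable pairs.
\<close>

record ('o, 'a) cat =
  Obj :: "'o set"
  Arr :: "'a set"
  Src :: "'a \<Rightarrow> 'o"
  Tgt :: "'a \<Rightarrow> 'o"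
  Idn :: "'o \<Rightarrow> 'a"
  Comp :: "'a \<Rightarrow> 'a \<Rightarrow> 'a"  (infixl "\<cdot>\<index>" 70)

locale category =
  fixes C :: "('o, 'a) cat" (structure)
  assumes Src_in: "f \<in> Arr C \<Longrightarrow> Src C f \<in> Obj C"
    and Tgt_in: "f \<in> Arr C \<Longrightarrow> Tgt C f \<in> Obj C"
    and Idn_in: "x \<in> Obj C \<Longrightarrow> Idn C x \<in> Arr C"
    and Src_Idn: "x \<in> Obj C \<Longrightarrow> Src C (Idn C x) = x"
    and Tgt_Idn: "x \<in> Obj C \<Longrightarrow> Tgt C (Idn C x) = x"
    and Comp_in: "\<lbrakk>f \<in> Arr C; g \<in> Arr C; Tgt C f = Src C g\<rbrakk> \<Longrightarrow> f \<cdot> g \<in> Arr C"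
    and Src_Comp: "\<lbrakk>f \<in> Arr C; g \<in> Arr C; Tgt C f = Src C g\<rbrakk> \<Longrightarrow> Src C (f \<cdot> g) = Src C f"
    and Tgt_Comp: "\<lbrakk>f \<in> Arr C; g \<in> Arr C; Tgt C f = Src C g\<rbrakk> \<Longrightarrow> Tgt C (f \<cdot> g) = Tgt C g"
    and Idn_Comp: "f \<in> Arr C \<Longrightarrow> Idn C (Src C f) \<cdot> f = f"
    and Comp_Idn: "f \<in> Arr C \<Longrightarrow> f \<cdot> Idn C (Tgt C f) = f"
    and Comp_assoc: "\<lbrakk>f \<in> Arr C; g \<in> Arr C; h \<in> Arr C; Tgt C f = Src C g; Tgt C g = Src C h\<rbrakk>
      \<Longrightarrow> (f \<cdot> g) \<cdot> h = f \<cdot> (g \<cdot> h)"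

locale groupoid = category C
  for C :: "('o, 'a) cat" (structure) +
  assumes invertible: "f \<in> Arr C \<Longrightarrow>
    \<exists>g \<in> Arr C. Src C g = Tgt C f \<and> Tgt C g = Src C f \<and>
      f \<cdot> g = Idn C (Src C f) \<and> g \<cdot> f = Idn C (Tgt C f)"

locale cat_functor = C: category C + D: category D
  for C :: "('o, 'a) cat" and D :: "('p, 'b) cat" +
  fixes F\<^sub>o :: "'o \<Rightarrow> 'p" and F :: "'a \<Rightarrow> 'b"
  assumes map_Obj: "x \<in> Obj C \<Longrightarrow> F\<^sub>o x \<in> Obj D"
    and map_Arr: "f \<in> Arr C \<Longrightarrow> F f \<in> Arr D"
    and map_Src: "f \<in> Arr C \<Longrightarrow> Src D (F f) = F\<^sub>o (Src C f)"
    and map_Tgt: "f \<in> Arr C \<Longrightarrow> Tgt D (F f) = F\<^sub>o (Tgt C f)"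
    and map_Idn: "x \<in> Obj C \<Longrightarrow> F (Idn C x) = Idn D (F\<^sub>o x)"
    and map_Comp: "\<lbrakk>f \<in> Arr C; g \<in> Arr C; Tgt C f = Src C g\<rbrakk>
      \<Longrightarrow> F (f \<cdot>\<^bsub>C\<^esub> g) = F f \<cdot>\<^bsub>D\<^esub> F g"


section \<open>Double categories\<close>

text \<open>
  \<open>H\<close> and \<open>V\<close> are the categories of horizontal and vertical edges. The squares form a category
  \<open>S\<^sub>2\<close> under horizontal composition, whose objects are the vertical edges (source and target of a
  square being its left and right edge), and a category \<open>S\<^sub>1\<close> under vertical composition, whose
  objects are the horizontal edges (source and target being the top and bottom edge).
  Compatibility of boundaries and identities with the compositions is expressed by
  functoriality; this includes the agreement of the corners of a square and of the two
  identity squares at an object.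
\<close>

locale double_category =
  left: cat_functor S\<^sub>1 V "Src H" "Src S\<^sub>2" +
  right: cat_functor S\<^sub>1 V "Tgt H" "Tgt S\<^sub>2" +
  top: cat_functor S\<^sub>2 H "Src V" "Src S\<^sub>1" +
  bottom: cat_functor S\<^sub>2 H "Tgt V" "Tgt S\<^sub>1" +
  idn2: cat_functor V S\<^sub>1 "Idn H" "Idn S\<^sub>2" +
  idn1: cat_functor H S\<^sub>2 "Idn V" "Idn S\<^sub>1"
  for H :: "('o, 'h) cat" and V :: "('o, 'v) cat"
    and S\<^sub>2 :: "('v, 's) cat" and S\<^sub>1 :: "('h, 's) cat" +
  assumes same_objects: "Obj H = Obj V"
    and same_squares: "Arr S\<^sub>2 = Arr S\<^sub>1"
    and Obj_S2: "Obj S\<^sub>2 = Arr V"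
    and Obj_S1: "Obj S\<^sub>1 = Arr H"
    and interchange:
      "\<lbrakk>\<alpha> \<in> Arr S\<^sub>1; \<beta> \<in> Arr S\<^sub>1; \<gamma> \<in> Arr S\<^sub>1; \<delta> \<in> Arr S\<^sub>1;
        Tgt S\<^sub>2 \<alpha> = Src S\<^sub>2 \<beta>; Tgt S\<^sub>2 \<gamma> = Src S\<^sub>2 \<delta>;
        Tgt S\<^sub>1 \<alpha> = Src S\<^sub>1 \<gamma>; Tgt S\<^sub>1 \<beta> = Src S\<^sub>1 \<delta>\<rbrakk>
      \<Longrightarrow> (\<alpha> \<cdot>\<^bsub>S\<^sub>2\<^esub> \<beta>) \<cdot>\<^bsub>S\<^sub>1\<^esub> (\<gamma> \<cdot>\<^bsub>S\<^sub>2\<^esub> \<delta>) = (\<alpha> \<cdot>\<^bsub>S\<^sub>1\<^esub> \<gamma>) \<cdot>\<^bsub>S\<^sub>2\<^esub> (\<beta> \<cdot>\<^bsub>S\<^sub>1\<^esub> \<delta>)"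

locale double_groupoid = double_category H V S\<^sub>2 S\<^sub>1 +
  H: groupoid H + V: groupoid V + S2: groupoid S\<^sub>2 + S1: groupoid S\<^sub>1
  for H :: "('o, 'h) cat" and V :: "('o, 'v) cat"
    and S\<^sub>2 :: "('v, 's) cat" and S\<^sub>1 :: "('h, 's) cat"


section \<open>Double modules\<close>

locale right_action = M: category M + H: category H
  for M :: "('o, 'm) cat" and H :: "('o, 'h) cat" +
  fixes act :: "'m \<Rightarrow> 'h \<Rightarrow> 'm"
  assumes act_in: "\<lbrakk>m \<in> Arr M; d \<in> Arr H; Tgt M m = Src H d\<rbrakk> \<Longrightarrow> act m d \<in> Arr M"
    and Src_act: "\<lbrakk>m \<in> Arr M; d \<in> Arr H; Tgt M m = Src H d\<rbrakk> \<Longrightarrow> Src M (act m d) = Tgt H d"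
    and Tgt_act: "\<lbrakk>m \<in> Arr M; d \<in> Arr H; Tgt M m = Src H d\<rbrakk> \<Longrightarrow> Tgt M (act m d) = Tgt H d"
    and Comp_act: "\<lbrakk>m \<in> Arr M; m' \<in> Arr M; d \<in> Arr H; Tgt M m = Src M m'; Tgt M m' = Src H d\<rbrakk>
      \<Longrightarrow> act (m \<cdot>\<^bsub>M\<^esub> m') d = act m d \<cdot>\<^bsub>M\<^esub> act m' d"
    and act_Comp: "\<lbrakk>m \<in> Arr M; d \<in> Arr H; f \<in> Arr H; Tgt M m = Src H d; Tgt H d = Src H f\<rbrakk>
      \<Longrightarrow> act m (d \<cdot>\<^bsub>H\<^esub> f) = act (act m d) f"
    and Idn_act: "d \<in> Arr H \<Longrightarrow> act (Idn M (Src H d)) d = Idn M (Tgt H d)"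
    and act_Idn: "m \<in> Arr M \<Longrightarrow> act m (Idn H (Tgt M m)) = m"

locale double_P_module =
  \<mu>: cat_functor M P "\<lambda>x. x" \<mu> +
  \<phi>: cat_functor H P "\<lambda>x. x" \<phi> +
  \<psi>: cat_functor V P "\<lambda>x. x" \<psi> +
  H: right_action M H actH +
  V: right_action M V actV
  for M :: "('o, 'm) cat" and H :: "('o, 'h) cat"
    and V :: "('o, 'v) cat" and P :: "('o, 'p) cat"
    and \<mu> :: "'m \<Rightarrow> 'p" and \<phi> :: "'h \<Rightarrow> 'p" and \<psi> :: "'v \<Rightarrow> 'p"
    and actH :: "'m \<Rightarrow> 'h \<Rightarrow> 'm" and actV :: "'m \<Rightarrow> 'v \<Rightarrow> 'm" +
  assumes Obj_M: "Obj M = Obj P" and Obj_H: "Obj H = Obj P" and Obj_V: "Obj V = Obj P"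
    and totally_intransitive: "m \<in> Arr M \<Longrightarrow> Src M m = Tgt M m"
    and actH_eval: "\<lbrakk>m \<in> Arr M; d \<in> Arr H; Tgt M m = Src H d\<rbrakk>
      \<Longrightarrow> \<mu> m \<cdot>\<^bsub>P\<^esub> \<phi> d = \<phi> d \<cdot>\<^bsub>P\<^esub> \<mu> (actH m d)"
    and actV_eval: "\<lbrakk>m \<in> Arr M; y \<in> Arr V; Tgt M m = Src V y\<rbrakk>
      \<Longrightarrow> \<mu> m \<cdot>\<^bsub>P\<^esub> \<psi> y = \<psi> y \<cdot>\<^bsub>P\<^esub> \<mu> (actV m y)"
    and exchange:
      "\<lbrakk>m \<in> Arr M; q \<in> Arr M; d \<in> Arr H; f \<in> Arr H; y \<in> Arr V; z \<in> Arr V;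
        Src V y = Src H d; Tgt V y = Src H f; Tgt H f = Src M q;
        Tgt H d = Src V z; Tgt M q = Tgt V z;
        \<psi> y \<cdot>\<^bsub>P\<^esub> \<phi> f \<cdot>\<^bsub>P\<^esub> \<mu> q = \<phi> d \<cdot>\<^bsub>P\<^esub> \<psi> z;
        Tgt M m = Src V y\<rbrakk>
      \<Longrightarrow> actH (actV m y) f \<cdot>\<^bsub>M\<^esub> q = q \<cdot>\<^bsub>M\<^esub> actV (actH m d) z"


section \<open>The squares of a double module\<close>

text \<open>\<open>Sq m u a c v\<close> has left edge \<open>u\<close>, top edge \<open>a\<close>, bottom edge \<open>c\<close> and right edge \<open>v\<close>.\<close>

datatype ('m, 'h, 'v) sq =
  Sq (elt_of: 'm) (left_of: 'v) (top_of: 'h) (bot_of: 'h) (right_of: 'v)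

text \<open>\<open>a v = u c m\<close> evaluated in \<open>P\<close>, including the conditions on sources and targets.\<close>

definition module_squares ::
  "('o, 'm) cat \<Rightarrow> ('o, 'h) cat \<Rightarrow> ('o, 'v) cat \<Rightarrow> ('o, 'p) cat \<Rightarrow>
   ('m \<Rightarrow> 'p) \<Rightarrow> ('h \<Rightarrow> 'p) \<Rightarrow> ('v \<Rightarrow> 'p) \<Rightarrow> ('m, 'h, 'v) sq set" where
  "module_squares M H V P \<mu> \<phi> \<psi> =
    {Sq m u a c v | m u a c v.
      m \<in> Arr M \<and> a \<in> Arr H \<and> c \<in> Arr H \<and> u \<in> Arr V \<and> v \<in> Arr V \<and>
      Src H a = Src V u \<and> Tgt H a = Src V v \<and> Tgt V u = Src H c \<and>
      Tgt H c = Tgt V v \<and> Tgt V v = Tgt M m \<and>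
      \<phi> a \<cdot>\<^bsub>P\<^esub> \<psi> v = \<psi> u \<cdot>\<^bsub>P\<^esub> \<phi> c \<cdot>\<^bsub>P\<^esub> \<mu> m}"

text \<open>
  The compositions are used only when the common edges agree, \<open>v' = v\<close> for \<open>hcomp\<close> and
  \<open>c' = c\<close> for \<open>vcomp\<close>.
\<close>

fun hcomp ::
  "('o, 'm) cat \<Rightarrow> ('o, 'h) cat \<Rightarrow> ('m \<Rightarrow> 'h \<Rightarrow> 'm) \<Rightarrow>
   ('m, 'h, 'v) sq \<Rightarrow> ('m, 'h, 'v) sq \<Rightarrow> ('m, 'h, 'v) sq" where
  "hcomp M H actH (Sq m u a c v) (Sq n v' b d w) =
    Sq (actH m d \<cdot>\<^bsub>M\<^esub> n) u (a \<cdot>\<^bsub>H\<^esub> b) (c \<cdot>\<^bsub>H\<^esub> d) w"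

fun vcomp ::
  "('o, 'm) cat \<Rightarrow> ('o, 'v) cat \<Rightarrow> ('m \<Rightarrow> 'v \<Rightarrow> 'm) \<Rightarrow>
   ('m, 'h, 'v) sq \<Rightarrow> ('m, 'h, 'v) sq \<Rightarrow> ('m, 'h, 'v) sq" where
  "vcomp M V actV (Sq m u a c v) (Sq p x c' e y) =
    Sq (p \<cdot>\<^bsub>M\<^esub> actV m y) (u \<cdot>\<^bsub>V\<^esub> x) a e (v \<cdot>\<^bsub>V\<^esub> y)"

text \<open>
  The identity squares are not extra data: being two-sided units, they are determined by the
  compositions.
\<close>

definition hsquares ::
  "('o, 'm) cat \<Rightarrow> ('o, 'h) cat \<Rightarrow> ('o, 'v) cat \<Rightarrow> ('o, 'p) cat \<Rightarrow>
   ('m \<Rightarrow> 'p) \<Rightarrow> ('h \<Rightarrow> 'p) \<Rightarrow> ('v \<Rightarrow> 'p) \<Rightarrow> ('m \<Rightarrow> 'h \<Rightarrow> 'm) \<Rightarrow>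
   ('v, ('m, 'h, 'v) sq) cat" where
  "hsquares M H V P \<mu> \<phi> \<psi> actH =
    \<lparr>Obj = Arr V, Arr = module_squares M H V P \<mu> \<phi> \<psi>, Src = left_of, Tgt = right_of,
     Idn = (\<lambda>u. Sq (Idn M (Tgt V u)) u (Idn H (Src V u)) (Idn H (Tgt V u)) u),
     Comp = hcomp M H actH\<rparr>"

definition vsquares ::
  "('o, 'm) cat \<Rightarrow> ('o, 'h) cat \<Rightarrow> ('o, 'v) cat \<Rightarrow> ('o, 'p) cat \<Rightarrow>
   ('m \<Rightarrow> 'p) \<Rightarrow> ('h \<Rightarrow> 'p) \<Rightarrow> ('v \<Rightarrow> 'p) \<Rightarrow> ('m \<Rightarrow> 'v \<Rightarrow> 'm) \<Rightarrow>
   ('h, ('m, 'h, 'v) sq) cat" where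
  "vsquares M H V P \<mu> \<phi> \<psi> actV =
    \<lparr>Obj = Arr H, Arr = module_squares M H V P \<mu> \<phi> \<psi>, Src = top_of, Tgt = bot_of,
     Idn = (\<lambda>a. Sq (Idn M (Tgt H a)) (Idn V (Src H a)) a a (Idn V (Tgt H a))),
     Comp = vcomp M V actV\<rparr>"

end

theory Submission
  imports Defs
begin

text \<open>
  An element of \<open>D\<close> is a square of arrows \<open>a, v, u, c\<close> which commutes in \<open>P\<close> up to a factor \<open>m\<close>
  sitting at its lower right-hand corner. When two squares are pasted, the composite boundary
  is compared in \<open>P\<close>, and the factor of the left or upper square, which no longer sits at the
  lower right-hand corner of the whole, must be carried there: along the bottom edge \<open>d\<close> of the right-hand square, or along the
  right edge \<open>y\<close> of the lower square. The rules \<open>m d = d m\<^sup>d\<close> and \<open>m y = y m\<^sup>y\<close> evaluated in \<open>P\<close>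
  say that the carried factor is \<open>m\<^sup>d\<close> or \<open>m\<^sup>y\<close>, which is exactly what the two compositions
  record. So \<open>D\<close> is closed under them (\<open>hcomp_in_D\<close>, \<open>vcomp_in_D\<close>), and associativity and the unit laws are the
  laws of an action together with those of \<open>M\<close>, \<open>H\<close>, \<open>V\<close>.

  In a \<open>2 \<times> 2\<close> array the factor \<open>m\<close> of the upper left square starts at the centre and travels to
  the outer corner around the lower right square \<open>(q : y d f z)\<close>: through \<open>d\<close> and then \<open>z\<close> if rows
  are composed first, through \<open>y\<close> and then \<open>f\<close> if columns are. The two results need not
  agree, but the exchange axiom, applied to the equation \<open>d z = y f q\<close> of that very square, says that
  they agree after multiplication by \<open>q\<close> on the appropriate sides:
  \<open>m\<^sup>y\<^sup>f q = q m\<^sup>d\<^sup>z\<close>. This gives \<open>interchange_law\<close>.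

  Inverses in the groupoid case invert the two edges along which one composes, and the factor is
  the inverse of \<open>m\<close> carried back along the inverted edge (\<open>groupoid_S2\<close>, \<open>groupoid_S1\<close>).
\<close>

section \<open>Pasting in a category\<close>

context category
begin

lemma unit_left: "\<lbrakk>f \<in> Arr C; Src C f = x\<rbrakk> \<Longrightarrow> Idn C x \<cdot> f = f"
  and unit_right: "\<lbrakk>f \<in> Arr C; Tgt C f = x\<rbrakk> \<Longrightarrow> f \<cdot> Idn C x = f"
  using Idn_Comp Comp_Idn by auto

lemmas hom_simps = Src_in Tgt_in Idn_in Src_Idn Tgt_Idn Comp_in Src_Comp Tgt_Comp unit_left unit_right

text \<open>
  These are the computations in \<open>P\<close> that show composites and inverses of squares to be squares.
  The arrow \<open>m'\<close> stands for the factor \<open>m\<close> after it has been carried past an edge.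
\<close>

lemma paste_horizontally:
  assumes [simp]: "a \<in> Arr C" "b \<in> Arr C" "c \<in> Arr C" "d \<in> Arr C" "u \<in> Arr C" "v \<in> Arr C"
      "w \<in> Arr C" "m \<in> Arr C" "m' \<in> Arr C" "n \<in> Arr C"
    and [simp]: "Tgt C a = Src C v" "Tgt C u = Src C c" "Tgt C c = Src C d" "Tgt C v = Src C d"
      "Src C m = Src C d" "Tgt C m = Src C d"
      "Src C b = Src C v" "Tgt C b = Src C w" "Tgt C d = Tgt C w" "Src C n = Tgt C w"
      "Src C m' = Tgt C w" "Tgt C m' = Tgt C w"
    and left: "a \<cdot> v = u \<cdot> c \<cdot> m" and right: "b \<cdot> w = v \<cdot> d \<cdot> n" and carry: "m \<cdot> d = d \<cdot> m'"
  shows "(a \<cdot> b) \<cdot> w = u \<cdot> (c \<cdot> d) \<cdot> (m' \<cdot> n)"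
proof -
  note [simp] = hom_simps
  have "(a \<cdot> b) \<cdot> w = a \<cdot> (v \<cdot> d \<cdot> n)" by (simp add: Comp_assoc right)
  also have "\<dots> = (a \<cdot> v) \<cdot> (d \<cdot> n)" by (simp add: Comp_assoc)
  also have "\<dots> = u \<cdot> (c \<cdot> ((m \<cdot> d) \<cdot> n))" by (simp add: left Comp_assoc)
  also have "\<dots> = u \<cdot> (c \<cdot> d) \<cdot> (m' \<cdot> n)" by (simp add: carry Comp_assoc)
  finally show ?thesis .
qed

lemma paste_vertically:
  assumes [simp]: "a \<in> Arr C" "c \<in> Arr C" "e \<in> Arr C" "u \<in> Arr C" "v \<in> Arr C" "x \<in> Arr C"
      "y \<in> Arr C" "m \<in> Arr C" "m' \<in> Arr C" "p \<in> Arr C"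
    and [simp]: "Tgt C a = Src C v" "Tgt C u = Src C c" "Tgt C c = Src C y" "Tgt C v = Src C y"
      "Src C m = Src C y" "Tgt C m = Src C y"
      "Src C x = Src C c" "Tgt C x = Src C e" "Tgt C e = Tgt C y" "Src C p = Tgt C y"
      "Tgt C p = Tgt C y" "Src C m' = Tgt C y" "Tgt C m' = Tgt C y"
    and upper: "a \<cdot> v = u \<cdot> c \<cdot> m" and lower: "c \<cdot> y = x \<cdot> e \<cdot> p" and carry: "m \<cdot> y = y \<cdot> m'"
  shows "a \<cdot> (v \<cdot> y) = (u \<cdot> x) \<cdot> e \<cdot> (p \<cdot> m')"
proof -
  note [simp] = hom_simps
  have "a \<cdot> (v \<cdot> y) = (a \<cdot> v) \<cdot> y" by (simp add: Comp_assoc)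
  also have "\<dots> = u \<cdot> (c \<cdot> (m \<cdot> y))" by (simp add: upper Comp_assoc)
  also have "\<dots> = u \<cdot> ((c \<cdot> y) \<cdot> m')" by (simp add: carry Comp_assoc)
  also have "\<dots> = (u \<cdot> x) \<cdot> e \<cdot> (p \<cdot> m')" by (simp add: lower Comp_assoc)
  finally show ?thesis .
qed

lemma reflect_horizontally:
  assumes [simp]: "a \<in> Arr C" "c \<in> Arr C" "u \<in> Arr C" "v \<in> Arr C" "m \<in> Arr C" "m' \<in> Arr C"
      "n \<in> Arr C" "a' \<in> Arr C" "c' \<in> Arr C"
    and [simp]: "Src C a = Src C u" "Tgt C a = Src C v" "Tgt C u = Src C c" "Tgt C c = Tgt C v"
      "Src C m = Tgt C v" "Tgt C m = Tgt C v"
      "Src C a' = Src C v" "Tgt C a' = Src C u" "Src C c' = Tgt C v" "Tgt C c' = Src C c"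
      "Src C m' = Src C c" "Tgt C m' = Src C c" "Src C n = Src C c" "Tgt C n = Src C c"
    and square: "a \<cdot> v = u \<cdot> c \<cdot> m" and carry: "m \<cdot> c' = c' \<cdot> m'"
    and a': "a' \<cdot> a = Idn C (Src C v)" and c': "c \<cdot> c' = Idn C (Src C c)"
    and n: "m' \<cdot> n = Idn C (Src C c)"
  shows "a' \<cdot> u = v \<cdot> c' \<cdot> n"
proof -
  note [simp] = hom_simps
  have "v \<cdot> c' \<cdot> n = Idn C (Src C v) \<cdot> (v \<cdot> (c' \<cdot> n))" by (simp add: Comp_assoc)
  also have "\<dots> = (a' \<cdot> a) \<cdot> (v \<cdot> (c' \<cdot> n))" by (simp only: a')
  also have "\<dots> = a' \<cdot> ((a \<cdot> v) \<cdot> (c' \<cdot> n))" by (simp add: Comp_assoc)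
  also have "\<dots> = a' \<cdot> (u \<cdot> (c \<cdot> ((m \<cdot> c') \<cdot> n)))" by (simp add: square Comp_assoc)
  also have "\<dots> = a' \<cdot> (u \<cdot> ((c \<cdot> c') \<cdot> (m' \<cdot> n)))" by (simp add: carry Comp_assoc)
  also have "\<dots> = a' \<cdot> u" by (simp add: c' n)
  finally show ?thesis by simp
qed

lemma reflect_vertically:
  assumes [simp]: "a \<in> Arr C" "c \<in> Arr C" "u \<in> Arr C" "v \<in> Arr C" "m \<in> Arr C" "m' \<in> Arr C"
      "n \<in> Arr C" "u' \<in> Arr C" "v' \<in> Arr C"
    and [simp]: "Src C a = Src C u" "Tgt C a = Src C v" "Tgt C u = Src C c" "Tgt C c = Tgt C v"
      "Src C m = Tgt C v" "Tgt C m = Tgt C v"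
      "Src C u' = Src C c" "Tgt C u' = Src C u" "Src C v' = Tgt C v" "Tgt C v' = Src C v"
      "Src C m' = Src C v" "Tgt C m' = Src C v" "Src C n = Src C v" "Tgt C n = Src C v"
    and square: "a \<cdot> v = u \<cdot> c \<cdot> m" and carry: "m \<cdot> v' = v' \<cdot> m'"
    and u': "u' \<cdot> u = Idn C (Src C c)" and v': "v \<cdot> v' = Idn C (Src C v)"
    and n: "m' \<cdot> n = Idn C (Src C v)"
  shows "c \<cdot> v' = u' \<cdot> a \<cdot> n"
proof -
  note [simp] = hom_simps
  have "u' \<cdot> a \<cdot> n = u' \<cdot> (a \<cdot> (Idn C (Src C v) \<cdot> n))" by (simp add: Comp_assoc)
  also have "\<dots> = u' \<cdot> (a \<cdot> ((v \<cdot> v') \<cdot> n))" by (simp only: v')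
  also have "\<dots> = u' \<cdot> ((a \<cdot> v) \<cdot> (v' \<cdot> n))" by (simp add: Comp_assoc)
  also have "\<dots> = (u' \<cdot> u) \<cdot> (c \<cdot> ((m \<cdot> v') \<cdot> n))" by (simp add: square Comp_assoc)
  also have "\<dots> = c \<cdot> (v' \<cdot> (m' \<cdot> n))" by (simp add: carry u' Comp_assoc)
  also have "\<dots> = c \<cdot> v'" by (simp add: n)
  finally show ?thesis by simp
qed

end

section \<open>The two categories of squares\<close>

context double_P_module
begin

abbreviation "D \<equiv> module_squares M H V P \<mu> \<phi> \<psi>"
abbreviation "S\<^sub>2 \<equiv> hsquares M H V P \<mu> \<phi> \<psi> actH"
abbreviation "S\<^sub>1 \<equiv> vsquares M H V P \<mu> \<phi> \<psi> actV"

(* The object maps of \<open>\<mu>\<close>, \<open>\<phi>\<close>, \<open>\<psi>\<close> are identities, so their map_Obj would loop as a rewrite rule. *)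
lemmas category_simps =
  \<mu>.C.hom_simps \<phi>.C.hom_simps \<psi>.C.hom_simps \<mu>.D.hom_simps
  \<mu>.map_Arr \<mu>.map_Src \<mu>.map_Tgt \<mu>.map_Idn \<mu>.map_Comp
  \<phi>.map_Arr \<phi>.map_Src \<phi>.map_Tgt \<phi>.map_Idn \<phi>.map_Comp
  \<psi>.map_Arr \<psi>.map_Src \<psi>.map_Tgt \<psi>.map_Idn \<psi>.map_Comp
  H.act_in H.Src_act H.Tgt_act H.Comp_act H.act_Comp
  V.act_in V.Src_act V.Tgt_act V.Comp_act V.act_Comp
  Obj_M Obj_H Obj_V totally_intransitive

lemma objects_of_arrows:
  "d \<in> Arr H \<Longrightarrow> Src H d \<in> Obj P" "d \<in> Arr H \<Longrightarrow> Tgt H d \<in> Obj P"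
  "y \<in> Arr V \<Longrightarrow> Src V y \<in> Obj P" "y \<in> Arr V \<Longrightarrow> Tgt V y \<in> Obj P"
  "m \<in> Arr M \<Longrightarrow> Tgt M m \<in> Obj P"
  using \<phi>.C.Src_in \<phi>.C.Tgt_in \<psi>.C.Src_in \<psi>.C.Tgt_in \<mu>.C.Tgt_in Obj_M Obj_H Obj_V by auto

declare category_simps [simp] objects_of_arrows [simp]

lemma Sq_in_D:
  "Sq m u a c v \<in> D \<longleftrightarrow>
    m \<in> Arr M \<and> a \<in> Arr H \<and> c \<in> Arr H \<and> u \<in> Arr V \<and> v \<in> Arr V \<and>
    Src H a = Src V u \<and> Tgt H a = Src V v \<and> Tgt V u = Src H c \<and>
    Tgt H c = Tgt V v \<and> Tgt V v = Tgt M m \<and>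
    \<phi> a \<cdot>\<^bsub>P\<^esub> \<psi> v = \<psi> u \<cdot>\<^bsub>P\<^esub> \<phi> c \<cdot>\<^bsub>P\<^esub> \<mu> m"
  by (auto simp: module_squares_def)

lemma Sq_boundary:
  assumes "Sq m u a c v \<in> D"
  shows "m \<in> Arr M" "a \<in> Arr H" "c \<in> Arr H" "u \<in> Arr V" "v \<in> Arr V"
    "Src H a = Src V u" "Tgt H a = Src V v" "Tgt V u = Src H c" "Tgt H c = Tgt M m"
    "Tgt V v = Tgt M m"
  using assms by (auto simp: Sq_in_D)

lemma edges_of_square:
  assumes "\<alpha> \<in> D"
  shows "left_of \<alpha> \<in> Arr V" "right_of \<alpha> \<in> Arr V" "top_of \<alpha> \<in> Arr H" "bot_of \<alpha> \<in> Arr H"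
    and "Src V (left_of \<alpha>) = Src H (top_of \<alpha>)" "Tgt V (left_of \<alpha>) = Src H (bot_of \<alpha>)"
      "Src V (right_of \<alpha>) = Tgt H (top_of \<alpha>)" "Tgt V (right_of \<alpha>) = Tgt H (bot_of \<alpha>)"
  using assms by (auto simp: module_squares_def)

lemma edges_of_composites:
  "top_of (hcomp M H actH \<alpha> \<beta>) = top_of \<alpha> \<cdot>\<^bsub>H\<^esub> top_of \<beta>"
  "bot_of (hcomp M H actH \<alpha> \<beta>) = bot_of \<alpha> \<cdot>\<^bsub>H\<^esub> bot_of \<beta>"
  "left_of (vcomp M V actV \<alpha> \<beta>) = left_of \<alpha> \<cdot>\<^bsub>V\<^esub> left_of \<beta>"
  "right_of (vcomp M V actV \<alpha> \<beta>) = right_of \<alpha> \<cdot>\<^bsub>V\<^esub> right_of \<beta>"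
  by (cases \<alpha>; cases \<beta>; simp)+

lemma S2_simps [simp]:
  "Obj S\<^sub>2 = Arr V" "Arr S\<^sub>2 = D" "Src S\<^sub>2 = left_of" "Tgt S\<^sub>2 = right_of"
  "Idn S\<^sub>2 u = Sq (Idn M (Tgt V u)) u (Idn H (Src V u)) (Idn H (Tgt V u)) u"
  "Comp S\<^sub>2 = hcomp M H actH"
  by (simp_all add: hsquares_def)

lemma S1_simps [simp]:
  "Obj S\<^sub>1 = Arr H" "Arr S\<^sub>1 = D" "Src S\<^sub>1 = top_of" "Tgt S\<^sub>1 = bot_of"
  "Idn S\<^sub>1 a = Sq (Idn M (Tgt H a)) (Idn V (Src H a)) a a (Idn V (Tgt H a))"
  "Comp S\<^sub>1 = vcomp M V actV"
  by (simp_all add: vsquares_def)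

lemma hcomp_in_D:
  assumes "Sq m u a c v \<in> D" "Sq n v b d w \<in> D"
  shows "Sq (actH m d \<cdot>\<^bsub>M\<^esub> n) u (a \<cdot>\<^bsub>H\<^esub> b) (c \<cdot>\<^bsub>H\<^esub> d) w \<in> D"
proof -
  have [simp]: "m \<in> Arr M" "a \<in> Arr H" "c \<in> Arr H" "u \<in> Arr V" "v \<in> Arr V"
      "n \<in> Arr M" "b \<in> Arr H" "d \<in> Arr H" "w \<in> Arr V"
      "Src H a = Src V u" "Tgt H a = Src V v" "Tgt V u = Src H c" "Tgt H c = Src H d"
      "Tgt V v = Src H d" "Tgt M m = Src H d" "Src H b = Src V v" "Tgt H b = Src V w"
      "Tgt H d = Tgt V w" "Tgt M n = Tgt V w"
    and "\<phi> a \<cdot>\<^bsub>P\<^esub> \<psi> v = \<psi> u \<cdot>\<^bsub>P\<^esub> \<phi> c \<cdot>\<^bsub>P\<^esub> \<mu> m" "\<phi> b \<cdot>\<^bsub>P\<^esub> \<psi> w = \<psi> v \<cdot>\<^bsub>P\<^esub> \<phi> d \<cdot>\<^bsub>P\<^esub> \<mu> n"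
    using assms by (auto simp: Sq_in_D)
  then have "(\<phi> a \<cdot>\<^bsub>P\<^esub> \<phi> b) \<cdot>\<^bsub>P\<^esub> \<psi> w = \<psi> u \<cdot>\<^bsub>P\<^esub> (\<phi> c \<cdot>\<^bsub>P\<^esub> \<phi> d) \<cdot>\<^bsub>P\<^esub> (\<mu> (actH m d) \<cdot>\<^bsub>P\<^esub> \<mu> n)"
    by (intro \<mu>.D.paste_horizontally[where v = "\<psi> v" and m = "\<mu> m"]) (simp_all add: actH_eval)
  then show ?thesis by (simp add: Sq_in_D)
qed

lemma vcomp_in_D:
  assumes "Sq m u a c v \<in> D" "Sq p x c e y \<in> D"
  shows "Sq (p \<cdot>\<^bsub>M\<^esub> actV m y) (u \<cdot>\<^bsub>V\<^esub> x) a e (v \<cdot>\<^bsub>V\<^esub> y) \<in> D"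
proof -
  have [simp]: "m \<in> Arr M" "a \<in> Arr H" "c \<in> Arr H" "u \<in> Arr V" "v \<in> Arr V"
      "p \<in> Arr M" "e \<in> Arr H" "x \<in> Arr V" "y \<in> Arr V"
      "Src H a = Src V u" "Tgt H a = Src V v" "Tgt V u = Src H c" "Tgt H c = Src V y"
      "Tgt V v = Src V y" "Tgt M m = Src V y" "Src V x = Src H c" "Tgt V x = Src H e"
      "Tgt H e = Tgt V y" "Tgt M p = Tgt V y"
    and "\<phi> a \<cdot>\<^bsub>P\<^esub> \<psi> v = \<psi> u \<cdot>\<^bsub>P\<^esub> \<phi> c \<cdot>\<^bsub>P\<^esub> \<mu> m" "\<phi> c \<cdot>\<^bsub>P\<^esub> \<psi> y = \<psi> x \<cdot>\<^bsub>P\<^esub> \<phi> e \<cdot>\<^bsub>P\<^esub> \<mu> p"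
    using assms by (auto simp: Sq_in_D)
  then have "\<phi> a \<cdot>\<^bsub>P\<^esub> (\<psi> v \<cdot>\<^bsub>P\<^esub> \<psi> y) = (\<psi> u \<cdot>\<^bsub>P\<^esub> \<psi> x) \<cdot>\<^bsub>P\<^esub> \<phi> e \<cdot>\<^bsub>P\<^esub> (\<mu> p \<cdot>\<^bsub>P\<^esub> \<mu> (actV m y))"
    by (intro \<mu>.D.paste_vertically[where c = "\<phi> c" and m = "\<mu> m"]) (simp_all add: actV_eval)
  then show ?thesis by (simp add: Sq_in_D)
qed

lemma hidentity_in_D:
  assumes "u \<in> Arr V"
  shows "Sq (Idn M (Tgt V u)) u (Idn H (Src V u)) (Idn H (Tgt V u)) u \<in> D"
  using assms by (simp add: Sq_in_D)

lemma videntity_in_D: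
  assumes "a \<in> Arr H"
  shows "Sq (Idn M (Tgt H a)) (Idn V (Src H a)) a a (Idn V (Tgt H a)) \<in> D"
  using assms by (simp add: Sq_in_D)

lemma act_units [simp]:
  "\<lbrakk>m \<in> Arr M; Tgt M m = x\<rbrakk> \<Longrightarrow> actH m (Idn H x) = m"
  "\<lbrakk>m \<in> Arr M; Tgt M m = x\<rbrakk> \<Longrightarrow> actV m (Idn V x) = m"
  "\<lbrakk>d \<in> Arr H; Src H d = x\<rbrakk> \<Longrightarrow> actH (Idn M x) d = Idn M (Tgt H d)"
  "\<lbrakk>y \<in> Arr V; Src V y = x\<rbrakk> \<Longrightarrow> actV (Idn M x) y = Idn M (Tgt V y)"
  using H.act_Idn V.act_Idn H.Idn_act V.Idn_act by auto

lemmas assoc_simps = \<mu>.C.Comp_assoc \<phi>.C.Comp_assoc \<psi>.C.Comp_assoc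

lemma hcomp_associates:
  assumes "Sq m u a c v \<in> D" "Sq n v b d w \<in> D" "Sq p w e f x \<in> D"
  shows "a \<cdot>\<^bsub>H\<^esub> b \<cdot>\<^bsub>H\<^esub> e = a \<cdot>\<^bsub>H\<^esub> (b \<cdot>\<^bsub>H\<^esub> e)" "c \<cdot>\<^bsub>H\<^esub> d \<cdot>\<^bsub>H\<^esub> f = c \<cdot>\<^bsub>H\<^esub> (d \<cdot>\<^bsub>H\<^esub> f)"
    "actH (actH m d \<cdot>\<^bsub>M\<^esub> n) f \<cdot>\<^bsub>M\<^esub> p = actH m (d \<cdot>\<^bsub>H\<^esub> f) \<cdot>\<^bsub>M\<^esub> (actH n f \<cdot>\<^bsub>M\<^esub> p)"
  using Sq_boundary[OF assms(1)] Sq_boundary[OF assms(2)] Sq_boundary[OF assms(3)]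
  by (simp_all add: assoc_simps)

lemma category_S2: "category S\<^sub>2"
proof
  fix \<alpha> \<beta> assume "\<alpha> \<in> Arr S\<^sub>2" "\<beta> \<in> Arr S\<^sub>2" "Tgt S\<^sub>2 \<alpha> = Src S\<^sub>2 \<beta>"
  then show "\<alpha> \<cdot>\<^bsub>S\<^sub>2\<^esub> \<beta> \<in> Arr S\<^sub>2" "Src S\<^sub>2 (\<alpha> \<cdot>\<^bsub>S\<^sub>2\<^esub> \<beta>) = Src S\<^sub>2 \<alpha>" "Tgt S\<^sub>2 (\<alpha> \<cdot>\<^bsub>S\<^sub>2\<^esub> \<beta>) = Tgt S\<^sub>2 \<beta>"
    by (cases \<alpha>; cases \<beta>; simp add: hcomp_in_D)+
next
  fix \<alpha> \<beta> \<gamma>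
  assume "\<alpha> \<in> Arr S\<^sub>2" "\<beta> \<in> Arr S\<^sub>2" "\<gamma> \<in> Arr S\<^sub>2" "Tgt S\<^sub>2 \<alpha> = Src S\<^sub>2 \<beta>" "Tgt S\<^sub>2 \<beta> = Src S\<^sub>2 \<gamma>"
  then show "\<alpha> \<cdot>\<^bsub>S\<^sub>2\<^esub> \<beta> \<cdot>\<^bsub>S\<^sub>2\<^esub> \<gamma> = \<alpha> \<cdot>\<^bsub>S\<^sub>2\<^esub> (\<beta> \<cdot>\<^bsub>S\<^sub>2\<^esub> \<gamma>)"
    by (cases \<alpha>; cases \<beta>; cases \<gamma>) (simp add: hcomp_associates)
next
  fix \<alpha> assume "\<alpha> \<in> Arr S\<^sub>2"
  then show "Idn S\<^sub>2 (Src S\<^sub>2 \<alpha>) \<cdot>\<^bsub>S\<^sub>2\<^esub> \<alpha> = \<alpha>" "\<alpha> \<cdot>\<^bsub>S\<^sub>2\<^esub> Idn S\<^sub>2 (Tgt S\<^sub>2 \<alpha>) = \<alpha>"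
    by (cases \<alpha>; simp add: Sq_boundary)+
qed (simp_all add: edges_of_square hidentity_in_D)

lemma vcomp_associates:
  assumes "Sq m u a c v \<in> D" "Sq n x c d y \<in> D" "Sq p w d f z \<in> D"
  shows "u \<cdot>\<^bsub>V\<^esub> x \<cdot>\<^bsub>V\<^esub> w = u \<cdot>\<^bsub>V\<^esub> (x \<cdot>\<^bsub>V\<^esub> w)" "v \<cdot>\<^bsub>V\<^esub> y \<cdot>\<^bsub>V\<^esub> z = v \<cdot>\<^bsub>V\<^esub> (y \<cdot>\<^bsub>V\<^esub> z)"
    "p \<cdot>\<^bsub>M\<^esub> actV (n \<cdot>\<^bsub>M\<^esub> actV m y) z = (p \<cdot>\<^bsub>M\<^esub> actV n z) \<cdot>\<^bsub>M\<^esub> actV m (y \<cdot>\<^bsub>V\<^esub> z)"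
  using Sq_boundary[OF assms(1)] Sq_boundary[OF assms(2)] Sq_boundary[OF assms(3)]
  by (simp_all add: assoc_simps)

lemma category_S1: "category S\<^sub>1"
proof
  fix \<alpha> \<beta> assume "\<alpha> \<in> Arr S\<^sub>1" "\<beta> \<in> Arr S\<^sub>1" "Tgt S\<^sub>1 \<alpha> = Src S\<^sub>1 \<beta>"
  then show "\<alpha> \<cdot>\<^bsub>S\<^sub>1\<^esub> \<beta> \<in> Arr S\<^sub>1" "Src S\<^sub>1 (\<alpha> \<cdot>\<^bsub>S\<^sub>1\<^esub> \<beta>) = Src S\<^sub>1 \<alpha>" "Tgt S\<^sub>1 (\<alpha> \<cdot>\<^bsub>S\<^sub>1\<^esub> \<beta>) = Tgt S\<^sub>1 \<beta>"
    by (cases \<alpha>; cases \<beta>; simp add: vcomp_in_D)+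
next
  fix \<alpha> \<beta> \<gamma>
  assume "\<alpha> \<in> Arr S\<^sub>1" "\<beta> \<in> Arr S\<^sub>1" "\<gamma> \<in> Arr S\<^sub>1" "Tgt S\<^sub>1 \<alpha> = Src S\<^sub>1 \<beta>" "Tgt S\<^sub>1 \<beta> = Src S\<^sub>1 \<gamma>"
  then show "\<alpha> \<cdot>\<^bsub>S\<^sub>1\<^esub> \<beta> \<cdot>\<^bsub>S\<^sub>1\<^esub> \<gamma> = \<alpha> \<cdot>\<^bsub>S\<^sub>1\<^esub> (\<beta> \<cdot>\<^bsub>S\<^sub>1\<^esub> \<gamma>)"
    by (cases \<alpha>; cases \<beta>; cases \<gamma>) (simp add: vcomp_associates)
next
  fix \<alpha> assume "\<alpha> \<in> Arr S\<^sub>1"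
  then show "Idn S\<^sub>1 (Src S\<^sub>1 \<alpha>) \<cdot>\<^bsub>S\<^sub>1\<^esub> \<alpha> = \<alpha>" "\<alpha> \<cdot>\<^bsub>S\<^sub>1\<^esub> Idn S\<^sub>1 (Tgt S\<^sub>1 \<alpha>) = \<alpha>"
    by (cases \<alpha>; simp add: Sq_boundary)+
qed (simp_all add: edges_of_square videntity_in_D)

section \<open>The double category\<close>

text \<open>
  The factor \<open>m\<close> of the upper left square meets the square \<open>(q : y d f z)\<close>, whose two ways round
  are compared by the exchange axiom.
\<close>

lemma interchange_law:
  assumes "Sq m u a c v \<in> D" "Sq n v b d w \<in> D" "Sq p x c e y \<in> D" "Sq q y d f z \<in> D"
  shows "(actH p f \<cdot>\<^bsub>M\<^esub> q) \<cdot>\<^bsub>M\<^esub> actV (actH m d \<cdot>\<^bsub>M\<^esub> n) z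
    = actH (p \<cdot>\<^bsub>M\<^esub> actV m y) f \<cdot>\<^bsub>M\<^esub> (q \<cdot>\<^bsub>M\<^esub> actV n z)"
proof -
  have [simp]: "m \<in> Arr M" "n \<in> Arr M" "p \<in> Arr M" "q \<in> Arr M" "d \<in> Arr H" "f \<in> Arr H"
      "y \<in> Arr V" "z \<in> Arr V" "Tgt M m = Src V y" "Src H d = Src V y" "Tgt H d = Src V z"
      "Tgt M n = Src V z" "Tgt V y = Src H f" "Tgt M p = Src H f" "Tgt H f = Tgt V z"
      "Tgt M q = Tgt V z"
    and "\<phi> d \<cdot>\<^bsub>P\<^esub> \<psi> z = \<psi> y \<cdot>\<^bsub>P\<^esub> \<phi> f \<cdot>\<^bsub>P\<^esub> \<mu> q"
    using assms by (auto simp: Sq_in_D)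
  then have around: "actH (actV m y) f \<cdot>\<^bsub>M\<^esub> q = q \<cdot>\<^bsub>M\<^esub> actV (actH m d) z"
    by (intro exchange) simp_all
  have "(actH p f \<cdot>\<^bsub>M\<^esub> q) \<cdot>\<^bsub>M\<^esub> actV (actH m d \<cdot>\<^bsub>M\<^esub> n) z
      = actH p f \<cdot>\<^bsub>M\<^esub> ((q \<cdot>\<^bsub>M\<^esub> actV (actH m d) z) \<cdot>\<^bsub>M\<^esub> actV n z)"
    by (simp add: assoc_simps)
  also have "\<dots> = actH p f \<cdot>\<^bsub>M\<^esub> ((actH (actV m y) f \<cdot>\<^bsub>M\<^esub> q) \<cdot>\<^bsub>M\<^esub> actV n z)"
    by (simp only: around)
  also have "\<dots> = actH (p \<cdot>\<^bsub>M\<^esub> actV m y) f \<cdot>\<^bsub>M\<^esub> (q \<cdot>\<^bsub>M\<^esub> actV n z)"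
    by (simp add: assoc_simps)
  finally show ?thesis .
qed

lemma double_category_of_squares: "double_category H V S\<^sub>2 S\<^sub>1"
proof (intro double_category.intro double_category_axioms.intro cat_functor.intro
    category_S1 category_S2 \<phi>.C.category_axioms \<psi>.C.category_axioms)
  show "cat_functor_axioms S\<^sub>1 V (Src H) (Src S\<^sub>2)"
    by (rule cat_functor_axioms.intro) (simp_all add: edges_of_square edges_of_composites)
  show "cat_functor_axioms S\<^sub>1 V (Tgt H) (Tgt S\<^sub>2)"
    by (rule cat_functor_axioms.intro) (simp_all add: edges_of_square edges_of_composites)
  show "cat_functor_axioms S\<^sub>2 H (Src V) (Src S\<^sub>1)"
    by (rule cat_functor_axioms.intro) (simp_all add: edges_of_square edges_of_composites)
  show "cat_functor_axioms S\<^sub>2 H (Tgt V) (Tgt S\<^sub>1)"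
    by (rule cat_functor_axioms.intro) (simp_all add: edges_of_square edges_of_composites)
  show "cat_functor_axioms V S\<^sub>1 (Idn H) (Idn S\<^sub>2)"
    by (rule cat_functor_axioms.intro) (simp_all add: hidentity_in_D)
  show "cat_functor_axioms H S\<^sub>2 (Idn V) (Idn S\<^sub>1)"
    by (rule cat_functor_axioms.intro) (simp_all add: videntity_in_D)
  fix \<alpha> \<beta> \<gamma> \<delta>
  assume "\<alpha> \<in> Arr S\<^sub>1" "\<beta> \<in> Arr S\<^sub>1" "\<gamma> \<in> Arr S\<^sub>1" "\<delta> \<in> Arr S\<^sub>1"
    "Tgt S\<^sub>2 \<alpha> = Src S\<^sub>2 \<beta>" "Tgt S\<^sub>2 \<gamma> = Src S\<^sub>2 \<delta>" "Tgt S\<^sub>1 \<alpha> = Src S\<^sub>1 \<gamma>" "Tgt S\<^sub>1 \<beta> = Src S\<^sub>1 \<delta>"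
  then show "(\<alpha> \<cdot>\<^bsub>S\<^sub>2\<^esub> \<beta>) \<cdot>\<^bsub>S\<^sub>1\<^esub> (\<gamma> \<cdot>\<^bsub>S\<^sub>2\<^esub> \<delta>) = (\<alpha> \<cdot>\<^bsub>S\<^sub>1\<^esub> \<gamma>) \<cdot>\<^bsub>S\<^sub>2\<^esub> (\<beta> \<cdot>\<^bsub>S\<^sub>1\<^esub> \<delta>)"
    by (cases \<alpha>; cases \<beta>; cases \<gamma>; cases \<delta>)
      (auto simp: interchange_law simp del: H.Comp_act V.Comp_act)
qed simp_all

section \<open>Inverse squares\<close>

lemma inverse_in_M:
  assumes "groupoid M" "m \<in> Arr M"
  obtains n where "n \<in> Arr M" "Tgt M n = Tgt M m"
    "m \<cdot>\<^bsub>M\<^esub> n = Idn M (Tgt M m)" "n \<cdot>\<^bsub>M\<^esub> m = Idn M (Tgt M m)"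
  using groupoid.invertible[OF assms] assms(2) by auto

text \<open>
  The right inverse equation asks for a factor \<open>n\<close> with \<open>m\<^bsup>c'\<^esup> n = 1\<close>, where \<open>c'\<close> is inverse to \<open>c\<close>; the
  left one then reads \<open>n\<^sup>c m = 1\<close> and follows from \<open>n m\<^bsup>c'\<^esup> = 1\<close> by acting with \<open>c\<close>.
\<close>

lemma groupoid_S2:
  assumes M: "groupoid M" and H: "groupoid H"
  shows "groupoid S\<^sub>2"
proof (intro groupoid.intro category_S2 groupoid_axioms.intro)
  fix \<alpha> assume "\<alpha> \<in> Arr S\<^sub>2"
  then obtain m u a c v where \<alpha>: "\<alpha> = Sq m u a c v" and D: "Sq m u a c v \<in> D"
    by (cases \<alpha>) auto
  have [simp]: "m \<in> Arr M" "a \<in> Arr H" "c \<in> Arr H" "u \<in> Arr V" "v \<in> Arr V"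
      "Src H a = Src V u" "Tgt H a = Src V v" "Tgt V u = Src H c" "Tgt H c = Tgt V v"
      "Tgt M m = Tgt V v"
    and square: "\<phi> a \<cdot>\<^bsub>P\<^esub> \<psi> v = \<psi> u \<cdot>\<^bsub>P\<^esub> \<phi> c \<cdot>\<^bsub>P\<^esub> \<mu> m"
    using D by (auto simp: Sq_in_D)
  obtain a' where [simp]: "a' \<in> Arr H" "Src H a' = Src V v" "Tgt H a' = Src V u"
      "a \<cdot>\<^bsub>H\<^esub> a' = Idn H (Src V u)" and a': "a' \<cdot>\<^bsub>H\<^esub> a = Idn H (Src V v)"
    using groupoid.invertible[OF H, of a] by auto
  obtain c' where [simp]: "c' \<in> Arr H" "Src H c' = Tgt V v" "Tgt H c' = Src H c"
      and c': "c \<cdot>\<^bsub>H\<^esub> c' = Idn H (Src H c)" "c' \<cdot>\<^bsub>H\<^esub> c = Idn H (Tgt V v)"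
    using groupoid.invertible[OF H, of c] by auto
  obtain n where [simp]: "n \<in> Arr M" "Tgt M n = Src H c"
      and n: "actH m c' \<cdot>\<^bsub>M\<^esub> n = Idn M (Src H c)" "n \<cdot>\<^bsub>M\<^esub> actH m c' = Idn M (Src H c)"
    using inverse_in_M[OF M, of "actH m c'"] by auto
  have "\<phi> a' \<cdot>\<^bsub>P\<^esub> \<psi> u = \<psi> v \<cdot>\<^bsub>P\<^esub> \<phi> c' \<cdot>\<^bsub>P\<^esub> \<mu> n"
  proof (rule \<mu>.D.reflect_horizontally[where a = "\<phi> a" and c = "\<phi> c" and m = "\<mu> m"
        and m' = "\<mu> (actH m c')"])
    show "\<phi> a' \<cdot>\<^bsub>P\<^esub> \<phi> a = Idn P (Src P (\<psi> v))" using \<phi>.map_Comp[of a' a] a' by simp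
    show "\<phi> c \<cdot>\<^bsub>P\<^esub> \<phi> c' = Idn P (Src P (\<phi> c))" using \<phi>.map_Comp[of c c'] c' by simp
    show "\<mu> (actH m c') \<cdot>\<^bsub>P\<^esub> \<mu> n = Idn P (Src P (\<phi> c))"
      using \<mu>.map_Comp[of "actH m c'" n] n by simp
    show "\<mu> m \<cdot>\<^bsub>P\<^esub> \<phi> c' = \<phi> c' \<cdot>\<^bsub>P\<^esub> \<mu> (actH m c')" by (rule actH_eval) simp_all
  qed (use square in simp_all)
  then have D': "Sq n v a' c' u \<in> D" by (simp add: Sq_in_D)
  have "actH n c \<cdot>\<^bsub>M\<^esub> m = actH n c \<cdot>\<^bsub>M\<^esub> actH (actH m c') c"
    using H.act_Comp[of m c' c] by (simp add: c')
  also have "\<dots> = Idn M (Tgt V v)"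
    using H.Comp_act[of n "actH m c'" c] by (simp add: n)
  finally have "actH n c \<cdot>\<^bsub>M\<^esub> m = Idn M (Tgt V v)" .
  with D' a' c' n
  show "\<exists>\<beta>\<in>Arr S\<^sub>2. Src S\<^sub>2 \<beta> = Tgt S\<^sub>2 \<alpha> \<and> Tgt S\<^sub>2 \<beta> = Src S\<^sub>2 \<alpha> \<and>
      \<alpha> \<cdot>\<^bsub>S\<^sub>2\<^esub> \<beta> = Idn S\<^sub>2 (Src S\<^sub>2 \<alpha>) \<and> \<beta> \<cdot>\<^bsub>S\<^sub>2\<^esub> \<alpha> = Idn S\<^sub>2 (Tgt S\<^sub>2 \<alpha>)"
    by (intro bexI[of _ "Sq n v a' c' u"]) (simp_all add: \<alpha>)
qed

text \<open>
  With \<open>v'\<close> inverse to \<open>v\<close>, the equations are now \<open>n m\<^bsup>v'\<^esup> = 1\<close> and \<open>m n\<^sup>v = 1\<close>, and the second is the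
  image of \<open>m\<^bsup>v'\<^esup> n = 1\<close> under \<open>v\<close>.
\<close>

lemma groupoid_S1:
  assumes M: "groupoid M" and V: "groupoid V"
  shows "groupoid S\<^sub>1"
proof (intro groupoid.intro category_S1 groupoid_axioms.intro)
  fix \<alpha> assume "\<alpha> \<in> Arr S\<^sub>1"
  then obtain m u a c v where \<alpha>: "\<alpha> = Sq m u a c v" and D: "Sq m u a c v \<in> D"
    by (cases \<alpha>) auto
  have [simp]: "m \<in> Arr M" "a \<in> Arr H" "c \<in> Arr H" "u \<in> Arr V" "v \<in> Arr V"
      "Src H a = Src V u" "Tgt H a = Src V v" "Tgt V u = Src H c" "Tgt H c = Tgt V v"
      "Tgt M m = Tgt V v"
    and square: "\<phi> a \<cdot>\<^bsub>P\<^esub> \<psi> v = \<psi> u \<cdot>\<^bsub>P\<^esub> \<phi> c \<cdot>\<^bsub>P\<^esub> \<mu> m"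
    using D by (auto simp: Sq_in_D)
  obtain u' where [simp]: "u' \<in> Arr V" "Src V u' = Src H c" "Tgt V u' = Src V u"
      "u \<cdot>\<^bsub>V\<^esub> u' = Idn V (Src V u)" and u': "u' \<cdot>\<^bsub>V\<^esub> u = Idn V (Src H c)"
    using groupoid.invertible[OF V, of u] by auto
  obtain v' where [simp]: "v' \<in> Arr V" "Src V v' = Tgt V v" "Tgt V v' = Src V v"
      and v': "v \<cdot>\<^bsub>V\<^esub> v' = Idn V (Src V v)" "v' \<cdot>\<^bsub>V\<^esub> v = Idn V (Tgt V v)"
    using groupoid.invertible[OF V, of v] by auto
  obtain n where [simp]: "n \<in> Arr M" "Tgt M n = Src V v"
      and n: "actV m v' \<cdot>\<^bsub>M\<^esub> n = Idn M (Src V v)" "n \<cdot>\<^bsub>M\<^esub> actV m v' = Idn M (Src V v)"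
    using inverse_in_M[OF M, of "actV m v'"] by auto
  have "\<phi> c \<cdot>\<^bsub>P\<^esub> \<psi> v' = \<psi> u' \<cdot>\<^bsub>P\<^esub> \<phi> a \<cdot>\<^bsub>P\<^esub> \<mu> n"
  proof (rule \<mu>.D.reflect_vertically[where u = "\<psi> u" and v = "\<psi> v" and m = "\<mu> m"
        and m' = "\<mu> (actV m v')"])
    show "\<psi> u' \<cdot>\<^bsub>P\<^esub> \<psi> u = Idn P (Src P (\<phi> c))" using \<psi>.map_Comp[of u' u] u' by simp
    show "\<psi> v \<cdot>\<^bsub>P\<^esub> \<psi> v' = Idn P (Src P (\<psi> v))" using \<psi>.map_Comp[of v v'] v' by simp
    show "\<mu> (actV m v') \<cdot>\<^bsub>P\<^esub> \<mu> n = Idn P (Src P (\<psi> v))"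
      using \<mu>.map_Comp[of "actV m v'" n] n by simp
    show "\<mu> m \<cdot>\<^bsub>P\<^esub> \<psi> v' = \<psi> v' \<cdot>\<^bsub>P\<^esub> \<mu> (actV m v')" by (rule actV_eval) simp_all
  qed (use square in simp_all)
  then have D': "Sq n u' c a v' \<in> D" by (simp add: Sq_in_D)
  have "m \<cdot>\<^bsub>M\<^esub> actV n v = actV (actV m v') v \<cdot>\<^bsub>M\<^esub> actV n v"
    using V.act_Comp[of m v' v] by (simp add: v')
  also have "\<dots> = Idn M (Tgt V v)"
    using V.Comp_act[of "actV m v'" n v] by (simp add: n)
  finally have "m \<cdot>\<^bsub>M\<^esub> actV n v = Idn M (Tgt V v)" .
  with D' u' v' n
  show "\<exists>\<beta>\<in>Arr S\<^sub>1. Src S\<^sub>1 \<beta> = Tgt S\<^sub>1 \<alpha> \<and> Tgt S\<^sub>1 \<beta> = Src S\<^sub>1 \<alpha> \<and>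
      \<alpha> \<cdot>\<^bsub>S\<^sub>1\<^esub> \<beta> = Idn S\<^sub>1 (Src S\<^sub>1 \<alpha>) \<and> \<beta> \<cdot>\<^bsub>S\<^sub>1\<^esub> \<alpha> = Idn S\<^sub>1 (Tgt S\<^sub>1 \<alpha>)"
    by (intro bexI[of _ "Sq n u' c a v'"]) (simp_all add: \<alpha>)
qed

end

theorem theorem1p2:
  fixes M :: "('o, 'm) cat" and H :: "('o, 'h) cat"
    and V :: "('o, 'v) cat" and P :: "('o, 'p) cat"
    and \<mu> :: "'m \<Rightarrow> 'p" and \<phi> :: "'h \<Rightarrow> 'p" and \<psi> :: "'v \<Rightarrow> 'p"
    and actH :: "'m \<Rightarrow> 'h \<Rightarrow> 'm" and actV :: "'m \<Rightarrow> 'v \<Rightarrow> 'm"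
  assumes "double_P_module M H V P \<mu> \<phi> \<psi> actH actV"
  shows "double_category H V
           (hsquares M H V P \<mu> \<phi> \<psi> actH) (vsquares M H V P \<mu> \<phi> \<psi> actV) \<and>
         (groupoid M \<and> groupoid H \<and> groupoid V \<and> groupoid P \<longrightarrow>
           double_groupoid H V
             (hsquares M H V P \<mu> \<phi> \<psi> actH) (vsquares M H V P \<mu> \<phi> \<psi> actV))"
proof -
  interpret double_P_module M H V P \<mu> \<phi> \<psi> actH actV by (rule assms)
  show ?thesis
    by (intro conjI impI double_groupoid.intro double_category_of_squares groupoid_S1 groupoid_S2)
      simp_all
qed

end
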